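(* Let $f:\mathbb{R}^n\to\mathbb{R}$ be a three times differentiable function that is strongly convex with parameter $m>0$ and whose third derivative is Lipschitz continuous with parameter $L$. Suppose that $f$ has a strict global minimum $x^*$. Then there exist scalars $C$ and $D>0$ such that if $\|x^0-x^*\|<D$, then the iterates of the Unregularized Third-Order Newton's Method started at $x^0$ (which takes $x^{k+1}$ to be the local minimum of the third-order Taylor expansion $\Phi_{f,x^k}$ of $f$ around $x^k$) are well defined and satisfy $$\|x^{k+1}-x^*\|\le C\|x^k-x^*\|^3$$ for every $k$ for which the method performs the step from $x^k$ to $x^{k+1}$.
   Context: For vectors, $\|\cdot\|$ is the Euclidean norm. For a symmetric $n\times n\times n$ tensor $H=\{H_1,\dots,H_n\}$ (matrices with $(H_i)_{jk}=(H_j)_{ik}=(H_k)_{ij}$), $\|H\|=\max_{\|x\|,\|y\|,\|z\|\le 1}\sum_{i=1}^n x^T y_iH_i z$. Let $\nabla_i^3 f(x)$ be the $n\times n$ matrix whose $(j,k)$ entry is $\frac{\partial^3 f}{\partial x_i\partial x_j\partial x_k}(x)$; the third derivative of $f$ at $x$ is the tensor $\nabla^3 f(x)=\{\nabla_1^3 f(x),\dots,\nabla_n^3 f(x)\}$, and it is Lipschitz continuous with parameter $L$ if $\|\nabla^3 f(x)-\nabla^3 f(y)\|\le L\|x-y\|$ for all $x,y\in\mathbb{R}^n$. $f$ is strongly convex with parameter $m>0$ if $\nabla^2 f(x)\succeq mI$ for all $x\in\mathbb{R}^n$ (i.e. $\nabla^2 f(x)-mI$ is positive semidefinite). The third-order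 Taylor expansion of $f$ around $\bar{x}$ is the cubic polynomial $$\Phi_{f,\bar{x}}(x)=f(\bar{x})+\nabla f(\bar{x})^T(x-\bar{x})+\tfrac12 (x-\bar{x})^T\nabla^2 f(\bar{x})(x-\bar{x})+\tfrac16\sum_{i=1}^n (x-\bar{x})_i\,(x-\bar{x})^T\nabla_i^3 f(\bar{x})(x-\bar{x}).$$ Unregularized Third-Order Newton's Method: given $f$, a threshold $\epsilon>0$ and an initial point $x^0$, set $k=0$; while $\|\nabla f(x^k)\|>\epsilon$, let $x^{k+1}$ be the local minimum of $\Phi_{f,x^k}$ and set $k=k+1$; output $x^k$. (A cubic polynomial has either no local minimum, exactly one strict local minimum, or infinitely many non-strict local minima; the step is well defined when $\Phi_{f,x^k}$ has exactly one, strict, local minimum.) *)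

theory Defs
  imports "HOL-Analysis.Analysis"
begin

definition partial_derivative :: "'n::finite \<Rightarrow> (real ^ 'n \<Rightarrow> real) \<Rightarrow> real ^ 'n \<Rightarrow> real" where
  "partial_derivative i f x = deriv (\<lambda>t. f (x + t *\<^sub>R axis i 1)) 0"

definition gradient :: "(real ^ 'n::finite \<Rightarrow> real) \<Rightarrow> real ^ 'n \<Rightarrow> real ^ 'n" where
  "gradient f x = (\<chi> i. partial_derivative i f x)"

definition hessian :: "(real ^ 'n::finite \<Rightarrow> real) \<Rightarrow> real ^ 'n \<Rightarrow> real ^ 'n ^ 'n" where
  "hessian f x = (\<chi> i. \<chi> j. partial_derivative i (partial_derivative j f) x)"

text \<open>A tensor \<open>T :: real ^ 'n ^ 'n ^ 'n\<close> is read as the family of matrices \<open>T $ i\<close>.\<close>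

definition third_derivative :: "(real ^ 'n::finite \<Rightarrow> real) \<Rightarrow> real ^ 'n \<Rightarrow> real ^ 'n ^ 'n ^ 'n" where
  "third_derivative f x =
     (\<chi> i. \<chi> j. \<chi> k. partial_derivative i (partial_derivative j (partial_derivative k f)) x)"

text \<open>Differentiability is Frechet differentiability of \<open>f\<close>, of its gradient and of its Hessian
  at every point.\<close>

definition three_times_differentiable :: "(real ^ 'n::finite \<Rightarrow> real) \<Rightarrow> bool" where
  "three_times_differentiable f \<longleftrightarrow>
     (\<forall>x. f differentiable at x) \<and>
     (\<forall>x. gradient f differentiable at x) \<and>
     (\<forall>x. hessian f differentiable at x)"

text \<open>The maximum over the product of three unit balls is attained (a continuous function on a
  compact set), so it equals the supremum. The type's own \<open>norm\<close> is the Frobenius norm instead.\<close>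

definition tensor_norm :: "real ^ 'n::finite ^ 'n ^ 'n \<Rightarrow> real" where
  "tensor_norm T =
     Sup {(\<Sum>i\<in>UNIV. x \<bullet> ((y $ i *\<^sub>R T $ i) *v z)) | x y z.
            norm x \<le> 1 \<and> norm y \<le> 1 \<and> norm z \<le> 1}"

definition third_derivative_lipschitz :: "(real ^ 'n::finite \<Rightarrow> real) \<Rightarrow> real \<Rightarrow> bool" where
  "third_derivative_lipschitz f L \<longleftrightarrow>
     (\<forall>x y. tensor_norm (third_derivative f x - third_derivative f y) \<le> L * norm (x - y))"

text \<open>Symmetry is not part of this definition; it is automatic for the Hessian of a function
  whose gradient is Frechet differentiable.\<close>

definition positive_semidefinite :: "real ^ 'n::finite ^ 'n \<Rightarrow> bool" where
  "positive_semidefinite A \<longleftrightarrow> (\<forall>v. 0 \<le> v \<bullet> (A *v v))"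

definition strongly_convex :: "(real ^ 'n::finite \<Rightarrow> real) \<Rightarrow> real \<Rightarrow> bool" where
  "strongly_convex f m \<longleftrightarrow> (\<forall>x. positive_semidefinite (hessian f x - m *\<^sub>R mat 1))"

definition strict_global_minimum :: "(real ^ 'n::finite \<Rightarrow> real) \<Rightarrow> real ^ 'n \<Rightarrow> bool" where
  "strict_global_minimum f x \<longleftrightarrow> (\<forall>y. y \<noteq> x \<longrightarrow> f x < f y)"

definition local_minimum :: "(real ^ 'n::finite \<Rightarrow> real) \<Rightarrow> real ^ 'n \<Rightarrow> bool" where
  "local_minimum f x \<longleftrightarrow> (\<forall>\<^sub>F y in at x. f x \<le> f y)"

definition strict_local_minimum :: "(real ^ 'n::finite \<Rightarrow> real) \<Rightarrow> real ^ 'n \<Rightarrow> bool" where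
  "strict_local_minimum f x \<longleftrightarrow> (\<forall>\<^sub>F y in at x. f x < f y)"

definition taylor3 :: "(real ^ 'n::finite \<Rightarrow> real) \<Rightarrow> real ^ 'n \<Rightarrow> real ^ 'n \<Rightarrow> real" where
  "taylor3 f a x =
     f a + gradient f a \<bullet> (x - a)
     + 1 / 2 * ((x - a) \<bullet> (hessian f a *v (x - a)))
     + 1 / 6 * (\<Sum>i\<in>UNIV. (x - a) $ i * ((x - a) \<bullet> (third_derivative f a $ i *v (x - a))))"

text \<open>The step from \<open>x\<close> is well defined when the expansion around \<open>x\<close> has exactly one local
  minimum and that minimum is strict. Only then is the description in \<open>newton3_step\<close> meaningful.\<close>

definition newton3_step_well_defined :: "(real ^ 'n::finite \<Rightarrow> real) \<Rightarrow> real ^ 'n \<Rightarrow> bool" where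
  "newton3_step_well_defined f x \<longleftrightarrow>
     (\<exists>y. strict_local_minimum (taylor3 f x) y \<and> (\<forall>z. local_minimum (taylor3 f x) z \<longrightarrow> z = y))"

definition newton3_step :: "(real ^ 'n::finite \<Rightarrow> real) \<Rightarrow> real ^ 'n \<Rightarrow> real ^ 'n" where
  "newton3_step f x = (THE y. local_minimum (taylor3 f x) y)"

text \<open>The iterates without the stopping test, which is added by \<open>newton3_performs_step\<close>: the
  method with threshold \<open>\<epsilon>\<close> performs step \<open>k\<close> iff the loop condition has held at
  all iterates up to and including the \<open>k\<close>-th.\<close>

primrec newton3_iterate :: "(real ^ 'n::finite \<Rightarrow> real) \<Rightarrow> real ^ 'n \<Rightarrow> nat \<Rightarrow> real ^ 'n" where
  "newton3_iterate f x0 0 = x0"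
| "newton3_iterate f x0 (Suc k) = newton3_step f (newton3_iterate f x0 k)"

definition newton3_performs_step ::
  "(real ^ 'n::finite \<Rightarrow> real) \<Rightarrow> real \<Rightarrow> real ^ 'n \<Rightarrow> nat \<Rightarrow> bool" where
  "newton3_performs_step f \<epsilon> x0 k \<longleftrightarrow> (\<forall>j\<le>k. \<epsilon> < norm (gradient f (newton3_iterate f x0 j)))"

end

theory Submission imports Defs begin

text \<open>
  The gradient of the Taylor cubic \<open>\<Phi>\<^sub>a\<close> approximates the gradient of \<open>f\<close> to third order. At the
  minimiser \<open>x*\<close> of \<open>f\<close> the slope of \<open>\<Phi>\<^sub>a\<close> is therefore only \<open>O(d\<^sup>3)\<close>, where \<open>d = \<bar>a - x*\<bar>\<close>
  (\<open>taylor3_linear_coeff_at_minimum\<close>). On a ball about \<open>x*\<close> whose radius depends on \<open>m\<close> and the size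
  of the third derivative, but not on \<open>a\<close>, the cubic \<open>\<Phi>\<^sub>a\<close> inherits strong convexity from the
  Hessian at \<open>a\<close>. A strongly convex function whose slope at a point is \<open>e\<close> has its minimum within
  \<open>O(e)\<close> of that point, so \<open>\<Phi>\<^sub>a\<close> has a strict local minimum within \<open>O(d\<^sup>3)\<close> of \<open>x*\<close>. It is the only
  local minimum, because a cubic polynomial on a line has at most one nondegenerate one
  (\<open>cubic_unique_local_minimum\<close>). For small \<open>d\<close> the new iterate is no further from \<open>x*\<close> than the
  old one, and the estimate can be iterated.

  The slope estimate is usually derived by Taylor expansion of the gradient, which needs the
  symmetry of the second and third derivatives. The proof below uses only Taylor expansion of \<open>f\<close>
  along lines. Both \<open>\<Phi>\<^sub>a\<close> and \<open>\<Phi>\<close> at \<open>x*\<close> agree with \<open>f\<close> up to \<open>O(d\<^sup>4)\<close> at points within distance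
  \<open>2d\<close> of \<open>x*\<close>, so they agree with each other up to \<open>O(d\<^sup>4)\<close> there. On a line their difference is a
  cubic polynomial, and its slope can be recovered from its values at distance \<open>d\<close> and \<open>2d\<close> by a
  difference quotient that is exact for cubics, so the slopes differ by \<open>O(d\<^sup>3)\<close>.
\<close>

section \<open>Trilinear forms and the tensor norm\<close>

definition tensor_form :: "real ^ 'n::finite ^ 'n ^ 'n \<Rightarrow> real ^ 'n \<Rightarrow> real ^ 'n \<Rightarrow> real ^ 'n \<Rightarrow> real"
  where "tensor_form T x y z = (\<Sum>i\<in>UNIV. x \<bullet> ((y $ i *\<^sub>R T $ i) *v z))"

lemma tensor_form_alt: "tensor_form T x y z = (\<Sum>i\<in>UNIV. y $ i * (x \<bullet> (T $ i *v z)))"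
  by (simp add: tensor_form_def scaleR_matrix_vector_assoc [symmetric])

lemma tensor_form_add:
  "tensor_form T (x + x') y z = tensor_form T x y z + tensor_form T x' y z"
  "tensor_form T x (y + y') z = tensor_form T x y z + tensor_form T x y' z"
  "tensor_form T x y (z + z') = tensor_form T x y z + tensor_form T x y z'"
  by (simp_all add: tensor_form_alt inner_left_distrib inner_right_distrib
      matrix_vector_right_distrib distrib_left distrib_right sum.distrib)

lemma tensor_form_scale:
  "tensor_form T (c *\<^sub>R x) y z = c * tensor_form T x y z"
  "tensor_form T x (c *\<^sub>R y) z = c * tensor_form T x y z"
  "tensor_form T x y (c *\<^sub>R z) = c * tensor_form T x y z"
  by (simp_all add: tensor_form_alt matrix_vector_mult_scaleR sum_distrib_left mult_ac)

lemma tensor_form_diff_tensor: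
  "tensor_form (S - T) x y z = tensor_form S x y z - tensor_form T x y z"
  by (simp add: tensor_form_alt matrix_vector_mult_diff_rdistrib inner_diff_right
      right_diff_distrib sum_subtractf)

text \<open>Without an upper bound the supremum in the tensor norm would be an arbitrary number. Any
  bound will do here; the sum of the operator norms of the slices is easy to obtain.\<close>

lemma tensor_form_bdd_above:
  "bdd_above {tensor_form T x y z | x y z. norm x \<le> 1 \<and> norm y \<le> 1 \<and> norm z \<le> 1}"
proof (rule bdd_aboveI [where M = "\<Sum>i\<in>UNIV. onorm ((*v) (T $ i))"])
  fix w assume "w \<in> {tensor_form T x y z | x y z. norm x \<le> 1 \<and> norm y \<le> 1 \<and> norm z \<le> 1}"
  then obtain x y z where w: "w = tensor_form T x y z"
    and n: "norm x \<le> 1" "norm y \<le> 1" "norm z \<le> 1" by blast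
  have "y $ i * (x \<bullet> (T $ i *v z)) \<le> onorm ((*v) (T $ i))" for i
  proof -
    have bl: "bounded_linear ((*v) (T $ i))" by (rule matrix_vector_mul_bounded_linear)
    have 1: "norm (T $ i *v z) \<le> onorm ((*v) (T $ i))"
      using onorm [OF bl, of z] onorm_pos_le [OF bl] n(3)
      by (metis mult.commute mult_left_le_one_le norm_ge_zero order_trans)
    have 2: "\<bar>x \<bullet> (T $ i *v z)\<bar> \<le> onorm ((*v) (T $ i))"
    proof -
      have "\<bar>x \<bullet> (T $ i *v z)\<bar> \<le> norm x * norm (T $ i *v z)" by (rule Cauchy_Schwarz_ineq2)
      also have "\<dots> \<le> norm (T $ i *v z)" using n(1) by (simp add: mult_left_le_one_le)
      finally show ?thesis using 1 by linarith
    qed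
    have 3: "\<bar>y $ i\<bar> \<le> 1" using component_le_norm_cart [of y i] n(2) by linarith
    have "y $ i * (x \<bullet> (T $ i *v z)) \<le> \<bar>y $ i\<bar> * \<bar>x \<bullet> (T $ i *v z)\<bar>"
      by (metis abs_ge_self abs_mult)
    also have "\<dots> \<le> \<bar>x \<bullet> (T $ i *v z)\<bar>" using 3 by (simp add: mult_left_le_one_le)
    finally show ?thesis using 2 by linarith
  qed
  then show "w \<le> (\<Sum>i\<in>UNIV. onorm ((*v) (T $ i)))"
    unfolding w tensor_form_alt by (intro sum_mono)
qed

lemma tensor_form_le_tensor_norm:
  assumes "norm x \<le> 1" "norm y \<le> 1" "norm z \<le> 1"
  shows "tensor_form T x y z \<le> tensor_norm T"
  unfolding tensor_norm_def tensor_form_def [symmetric]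
  by (rule cSup_upper [OF _ tensor_form_bdd_above]) (use assms in blast)

lemma tensor_norm_nonneg: "0 \<le> tensor_norm T"
  using tensor_form_le_tensor_norm [of 0 0 0 T] by (simp add: tensor_form_alt)

lemma tensor_norm_triangle:
  fixes S T :: "real ^ 'n::finite ^ 'n ^ 'n"
  shows "tensor_norm T \<le> tensor_norm S + tensor_norm (T - S)"
proof -
  have "Sup {tensor_form T x y z | x y z. norm x \<le> 1 \<and> norm y \<le> 1 \<and> norm z \<le> 1}
      \<le> tensor_norm S + tensor_norm (T - S)"
  proof (rule cSup_least)
    have "norm (0 :: real ^ 'n) \<le> 1" by simp
    then show "{tensor_form T x y z | x y z. norm x \<le> 1 \<and> norm y \<le> 1 \<and> norm z \<le> 1} \<noteq> {}"
      by blast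
  next
    fix w assume "w \<in> {tensor_form T x y z | x y z. norm x \<le> 1 \<and> norm y \<le> 1 \<and> norm z \<le> 1}"
    then obtain x y z where w: "w = tensor_form T x y z" and n: "norm x \<le> 1" "norm y \<le> 1" "norm z \<le> 1"
      by blast
    show "w \<le> tensor_norm S + tensor_norm (T - S)"
      using tensor_form_le_tensor_norm [OF n, of S] tensor_form_le_tensor_norm [OF n, of "T - S"]
      by (simp add: w tensor_form_diff_tensor)
  qed
  then show ?thesis by (simp add: tensor_norm_def tensor_form_def)
qed

lemma abs_tensor_form_le:
  fixes T :: "real ^ 'n::finite ^ 'n ^ 'n"
  shows "\<bar>tensor_form T x y z\<bar> \<le> tensor_norm T * norm x * norm y * norm z"
proof -
  have le: "tensor_form T x y z \<le> tensor_norm T * norm x * norm y * norm z" for x y z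
  proof -
    have "tensor_form T (norm x *\<^sub>R sgn x) (norm y *\<^sub>R sgn y) (norm z *\<^sub>R sgn z)
        = norm x * norm y * norm z * tensor_form T (sgn x) (sgn y) (sgn z)"
      by (simp only: tensor_form_scale mult_ac)
    moreover have "norm v *\<^sub>R sgn v = v" for v :: "real ^ 'n"
      by (cases "v = 0") (simp_all add: sgn_div_norm)
    ultimately have "tensor_form T x y z
        = norm x * norm y * norm z * tensor_form T (sgn x) (sgn y) (sgn z)" by simp
    also have "\<dots> \<le> norm x * norm y * norm z * tensor_norm T"
      by (intro mult_left_mono tensor_form_le_tensor_norm) (auto simp: norm_sgn)
    finally show ?thesis by (simp add: mult_ac)
  qed
  have "tensor_form T (- x) y z = - tensor_form T x y z"
    using tensor_form_scale(1) [of T "- 1" x y z] by simp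
  then show ?thesis using le [of x y z] le [of "- x" y z] by simp
qed

section \<open>Taylor expansion along lines\<close>

lemma differentiable_has_derivative_gradient:
  fixes F :: "real ^ 'n::finite \<Rightarrow> real"
  assumes "F differentiable at x"
  shows "(F has_derivative (\<lambda>v. gradient F x \<bullet> v)) (at x)"
proof -
  from assms obtain F' where F': "(F has_derivative F') (at x)"
    by (auto simp: differentiable_def)
  interpret bounded_linear F' using F' by (rule has_derivative_bounded_linear)
  have pd: "partial_derivative i F x = F' (axis i 1)" for i
  proof -
    have "((\<lambda>t. x + t *\<^sub>R axis i 1) has_derivative (\<lambda>t. t *\<^sub>R axis i 1)) (at 0)"
      by (auto intro!: derivative_eq_intros)
    then have "((\<lambda>t. F (x + t *\<^sub>R axis i 1)) has_derivative (\<lambda>t. F' (t *\<^sub>R axis i 1))) (at 0)"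
      using has_derivative_compose [of "\<lambda>t. x + t *\<^sub>R axis i 1" _ 0 UNIV F F'] F' by simp
    then have "((\<lambda>t. F (x + t *\<^sub>R axis i 1)) has_field_derivative F' (axis i 1)) (at 0)"
      by (simp add: has_field_derivative_def scaleR mult.commute [of _ "F' _"])
    then show ?thesis unfolding partial_derivative_def by (rule DERIV_imp_deriv)
  qed
  have "F' v = gradient F x \<bullet> v" for v
  proof -
    have "F' v = F' (\<Sum>i\<in>UNIV. v $ i *\<^sub>R axis i 1)"
      using basis_expansion [of v] by (simp add: scalar_mult_eq_scaleR)
    also have "\<dots> = (\<Sum>i\<in>UNIV. v $ i * F' (axis i 1))" by (simp add: sum scaleR)
    finally show ?thesis by (simp add: inner_vec_def gradient_def pd mult.commute)
  qed
  with F' show ?thesis by (metis (no_types, lifting) ext)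
qed

lemma has_real_derivative_along_line:
  fixes F :: "real ^ 'n::finite \<Rightarrow> real"
  assumes "F differentiable at (a + t *\<^sub>R h)"
  shows "((\<lambda>t. F (a + t *\<^sub>R h)) has_real_derivative
           (\<Sum>i\<in>UNIV. h $ i * partial_derivative i F (a + t *\<^sub>R h))) (at t)"
proof -
  have "((\<lambda>t. a + t *\<^sub>R h) has_derivative (\<lambda>t. t *\<^sub>R h)) (at t)"
    by (auto intro!: derivative_eq_intros)
  then have "((\<lambda>t. F (a + t *\<^sub>R h)) has_derivative (\<lambda>s. gradient F (a + t *\<^sub>R h) \<bullet> (s *\<^sub>R h))) (at t)"
    by (rule has_derivative_compose [where f = "\<lambda>t. a + t *\<^sub>R h" and x = t and g = F,
          OF _ differentiable_has_derivative_gradient [OF assms]])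
  moreover have "(\<lambda>s. gradient F (a + t *\<^sub>R h) \<bullet> (s *\<^sub>R h))
      = (*) (\<Sum>i\<in>UNIV. h $ i * partial_derivative i F (a + t *\<^sub>R h))"
    by (auto simp: fun_eq_iff inner_vec_def gradient_def sum_distrib_right sum_distrib_left mult_ac)
  ultimately show ?thesis by (simp add: has_field_derivative_def)
qed

lemma differentiable_vec_nth:
  "g differentiable at x \<Longrightarrow> (\<lambda>y. g y $ i) differentiable at x"
  unfolding differentiable_def by (blast intro: bounded_linear.has_derivative [OF bounded_linear_vec_nth])

lemma inner_matrix_vector_eq_sum:
  "u \<bullet> (A *v v) = (\<Sum>k\<in>UNIV. v $ k * (\<Sum>j\<in>UNIV. u $ j * A $ j $ k))" for u v :: "real ^ 'n::finite"
proof -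
  have "u \<bullet> (A *v v) = (\<Sum>j\<in>UNIV. \<Sum>k\<in>UNIV. v $ k * (u $ j * A $ j $ k))"
    by (simp add: inner_vec_def matrix_vector_mult_def sum_distrib_left mult_ac)
  also have "\<dots> = (\<Sum>k\<in>UNIV. \<Sum>j\<in>UNIV. v $ k * (u $ j * A $ j $ k))" by (rule sum.swap)
  finally show ?thesis by (simp add: sum_distrib_left)
qed

context
  fixes f :: "real ^ 'n::finite \<Rightarrow> real"
  assumes diff: "three_times_differentiable f"
begin

lemma deriv1_along_line:
  "((\<lambda>t. f (a + t *\<^sub>R h)) has_real_derivative gradient f (a + t *\<^sub>R h) \<bullet> h) (at t)"
  using has_real_derivative_along_line [of f a t h] diff
  by (simp add: three_times_differentiable_def inner_vec_def gradient_def mult.commute)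

lemma deriv2_along_line:
  "((\<lambda>t. gradient f (a + t *\<^sub>R h) \<bullet> h) has_real_derivative h \<bullet> (hessian f (a + t *\<^sub>R h) *v h)) (at t)"
proof -
  have "(\<lambda>x. gradient f x $ k) differentiable at x" for x k
    using diff by (intro differentiable_vec_nth) (simp add: three_times_differentiable_def)
  then have "(partial_derivative k f) differentiable at x" for x k
    by (simp add: gradient_def)
  then have "((\<lambda>t. \<Sum>k\<in>UNIV. h $ k * partial_derivative k f (a + t *\<^sub>R h)) has_real_derivative
     (\<Sum>k\<in>UNIV. h $ k * (\<Sum>j\<in>UNIV. h $ j * partial_derivative j (partial_derivative k f) (a + t *\<^sub>R h)))) (at t)"
    by (intro DERIV_sum DERIV_cmult has_real_derivative_along_line)
  then show ?thesis
    unfolding inner_matrix_vector_eq_sum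
    by (simp add: hessian_def inner_vec_def gradient_def mult.commute)
qed

lemma deriv3_along_line:
  "((\<lambda>t. h \<bullet> (hessian f (a + t *\<^sub>R h) *v h)) has_real_derivative
     tensor_form (third_derivative f (a + t *\<^sub>R h)) h h h) (at t)"
proof -
  have "(\<lambda>x. hessian f x $ j $ k) differentiable at x" for x j k
    using diff by (intro differentiable_vec_nth) (simp add: three_times_differentiable_def)
  then have "(partial_derivative j (partial_derivative k f)) differentiable at x" for x j k
    by (simp add: hessian_def)
  then have *: "((\<lambda>t. \<Sum>k\<in>UNIV. h $ k * (\<Sum>j\<in>UNIV. h $ j *
        partial_derivative j (partial_derivative k f) (a + t *\<^sub>R h))) has_real_derivative
     (\<Sum>k\<in>UNIV. h $ k * (\<Sum>j\<in>UNIV. h $ j * (\<Sum>i\<in>UNIV. h $ i *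
        partial_derivative i (partial_derivative j (partial_derivative k f)) (a + t *\<^sub>R h))))) (at t)"
    by (intro DERIV_sum DERIV_cmult has_real_derivative_along_line)
  have "tensor_form (third_derivative f x) h h h = (\<Sum>k\<in>UNIV. h $ k * (\<Sum>j\<in>UNIV. h $ j *
     (\<Sum>i\<in>UNIV. h $ i * partial_derivative i (partial_derivative j (partial_derivative k f)) x)))" for x
  proof -
    let ?P = "\<lambda>i j k. h $ i * (h $ k * (h $ j * partial_derivative i (partial_derivative j (partial_derivative k f)) x))"
    have "tensor_form (third_derivative f x) h h h = (\<Sum>i\<in>UNIV. \<Sum>k\<in>UNIV. \<Sum>j\<in>UNIV. ?P i j k)"
      by (simp add: tensor_form_alt inner_matrix_vector_eq_sum third_derivative_def sum_distrib_left)
    also have "\<dots> = (\<Sum>k\<in>UNIV. \<Sum>i\<in>UNIV. \<Sum>j\<in>UNIV. ?P i j k)" by (rule sum.swap)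
    also have "\<dots> = (\<Sum>k\<in>UNIV. \<Sum>j\<in>UNIV. \<Sum>i\<in>UNIV. ?P i j k)"
      by (rule sum.cong [OF refl]) (rule sum.swap)
    finally show ?thesis by (simp add: sum_distrib_left mult_ac)
  qed
  then show ?thesis using * by (simp add: inner_matrix_vector_eq_sum hessian_def)
qed

text \<open>Lagrange's form of the remainder puts the third derivative at an intermediate point; the
  Lipschitz condition compares it with the one at \<open>a\<close>.\<close>

lemma taylor3_error:
  assumes lip: "third_derivative_lipschitz f L"
  shows "\<bar>f (a + h) - taylor3 f a (a + h)\<bar> \<le> \<bar>L\<bar> / 6 * norm h ^ 4"
proof -
  define D where "D = (\<lambda>k t. [f (a + t *\<^sub>R h), gradient f (a + t *\<^sub>R h) \<bullet> h,
     h \<bullet> (hessian f (a + t *\<^sub>R h) *v h), tensor_form (third_derivative f (a + t *\<^sub>R h)) h h h] ! k)"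
  have step: "(D k has_real_derivative D (Suc k) t) (at t)" if "k < 3" for k t
  proof -
    from that have "k = 0 \<or> k = 1 \<or> k = 2" by linarith
    then show ?thesis
      using deriv1_along_line [of a h t] deriv2_along_line [of a h t] deriv3_along_line [of h a t]
      by (auto simp: D_def numeral_2_eq_2)
  qed
  obtain t where t: "0 < t" "t < 1"
    and eq: "D 0 1 = (\<Sum>k<3. D k 0 / fact k * 1 ^ k) + D 3 t / fact 3 * 1 ^ 3"
    using Maclaurin [of 1 3 D "D 0"] step by auto
  let ?T = "third_derivative f"
  have "f (a + h) - taylor3 f a (a + h) = (tensor_form (?T (a + t *\<^sub>R h)) h h h - tensor_form (?T a) h h h) / 6"
    using eq by (simp add: D_def taylor3_def tensor_form_alt eval_nat_numeral diff_divide_distrib)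
  also have "\<dots> = tensor_form (?T (a + t *\<^sub>R h) - ?T a) h h h / 6"
    by (simp add: tensor_form_diff_tensor)
  finally have "\<bar>f (a + h) - taylor3 f a (a + h)\<bar> = \<bar>tensor_form (?T (a + t *\<^sub>R h) - ?T a) h h h\<bar> / 6"
    by (simp only: abs_divide abs_numeral)
  then have "\<bar>f (a + h) - taylor3 f a (a + h)\<bar> \<le> tensor_norm (?T (a + t *\<^sub>R h) - ?T a) * norm h ^ 3 / 6"
    using abs_tensor_form_le [of "?T (a + t *\<^sub>R h) - ?T a" h h h]
    by (simp add: power3_eq_cube mult.assoc)
  moreover have "tensor_norm (?T (a + t *\<^sub>R h) - ?T a) \<le> \<bar>L\<bar> * norm h"
  proof -
    have "tensor_norm (?T (a + t *\<^sub>R h) - ?T a) \<le> L * norm (t *\<^sub>R h)"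
      using lip unfolding third_derivative_lipschitz_def by (metis add_diff_cancel_left')
    also have "\<dots> \<le> \<bar>L\<bar> * norm h"
      using t by (intro mult_mono) (auto simp: mult_left_le_one_le)
    finally show ?thesis .
  qed
  then have "tensor_norm (?T (a + t *\<^sub>R h) - ?T a) * norm h ^ 3 \<le> \<bar>L\<bar> * norm h * norm h ^ 3"
    by (intro mult_right_mono) auto
  ultimately show ?thesis by (simp add: eval_nat_numeral mult_ac)
qed

lemma gradient_at_minimum:
  assumes "strict_global_minimum f xs"
  shows "gradient f xs \<bullet> u = 0"
proof -
  have "f xs \<le> f y" for y
    using assms unfolding strict_global_minimum_def by (cases "y = xs") (auto intro: less_imp_le)
  then show ?thesis
    using DERIV_local_min [of "\<lambda>t. f (xs + t *\<^sub>R u)" "gradient f xs \<bullet> u" 0 1]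
      deriv1_along_line [of xs u 0] by simp
qed

end

section \<open>The Taylor cubic re-expanded around another point\<close>

text \<open>The coefficients of \<open>t\<close> and \<open>t\<^sup>2\<close> in \<open>taylor3 f a (y + t *\<^sub>R v)\<close>. The slot
  occupied by \<open>v\<close> matters, since symmetry of the Hessian and of the third derivative is never
  established.\<close>

definition taylor3_lin :: "(real ^ 'n::finite \<Rightarrow> real) \<Rightarrow> real ^ 'n \<Rightarrow> real ^ 'n \<Rightarrow> real ^ 'n \<Rightarrow> real" where
  "taylor3_lin f a y v = (let h = y - a; H = hessian f a; T = third_derivative f a in
     gradient f a \<bullet> v + (h \<bullet> (H *v v) + v \<bullet> (H *v h)) / 2
     + (tensor_form T h h v + tensor_form T h v h + tensor_form T v h h) / 6)"

definition taylor3_quad :: "(real ^ 'n::finite \<Rightarrow> real) \<Rightarrow> real ^ 'n \<Rightarrow> real ^ 'n \<Rightarrow> real ^ 'n \<Rightarrow> real" where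
  "taylor3_quad f a y v = (let h = y - a; H = hessian f a; T = third_derivative f a in
     v \<bullet> (H *v v) / 2 + (tensor_form T h v v + tensor_form T v h v + tensor_form T v v h) / 6)"

lemma taylor3_on_line:
  "taylor3 f a (y + t *\<^sub>R v) = taylor3 f a y + t * taylor3_lin f a y v + t^2 * taylor3_quad f a y v
     + t^3 * (tensor_form (third_derivative f a) v v v / 6)"
proof -
  have *: "taylor3 f a x = f a + gradient f a \<bullet> (x - a) + (x - a) \<bullet> (hessian f a *v (x - a)) / 2
     + tensor_form (third_derivative f a) (x - a) (x - a) (x - a) / 6" for x
    by (simp add: taylor3_def tensor_form_alt)
  define h where "h = y - a"
  have h: "y + t *\<^sub>R v - a = h + t *\<^sub>R v" "y - a = h" by (simp_all add: h_def)
  show ?thesis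
    unfolding * h taylor3_lin_def taylor3_quad_def Let_def
    by (simp add: tensor_form_add tensor_form_scale inner_left_distrib inner_right_distrib
        matrix_vector_right_distrib matrix_vector_mult_scaleR power2_eq_square power3_eq_cube
        add_divide_distrib algebra_simps)
qed

lemma continuous_on_taylor3: "continuous_on S (taylor3 f a)"
  unfolding taylor3_def
  by (intro continuous_intros bounded_linear.continuous_on [OF matrix_vector_mul_bounded_linear])

text \<open>The second-order part at \<open>a\<close> contributes \<open>m / 2\<close>; moving the centre from \<open>a\<close> to \<open>y\<close> changes
  this by three values of the third derivative with \<open>y - a\<close> in one slot, weighted by \<open>1 / 6\<close>.\<close>

lemma taylor3_quad_lower_bound:
  assumes "strongly_convex f m" "tensor_norm (third_derivative f a) \<le> N"
  shows "(m - N * norm (y - a)) / 2 * norm v ^ 2 \<le> taylor3_quad f a y v"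
proof -
  let ?h = "y - a" and ?T = "third_derivative f a"
  have "0 \<le> v \<bullet> ((hessian f a - m *\<^sub>R mat 1) *v v)"
    using assms(1) by (simp add: strongly_convex_def positive_semidefinite_def)
  then have 1: "m * norm v ^ 2 \<le> v \<bullet> (hessian f a *v v)"
    by (simp add: matrix_vector_mult_diff_rdistrib inner_diff_right power2_norm_eq_inner
        scaleR_matrix_vector_assoc [symmetric])
  have "tensor_norm ?T * (norm ?h * norm v ^ 2) \<le> N * (norm ?h * norm v ^ 2)"
    using assms(2) by (intro mult_right_mono) auto
  then have 2: "\<bar>tensor_form ?T ?h v v\<bar> \<le> N * (norm ?h * norm v ^ 2)"
    "\<bar>tensor_form ?T v ?h v\<bar> \<le> N * (norm ?h * norm v ^ 2)"
    "\<bar>tensor_form ?T v v ?h\<bar> \<le> N * (norm ?h * norm v ^ 2)"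
    using abs_tensor_form_le [of ?T ?h v v] abs_tensor_form_le [of ?T v ?h v]
      abs_tensor_form_le [of ?T v v ?h]
    by (auto simp: power2_eq_square mult_ac)
  have comb: "x / 2 - b / 2 \<le> w / 2 + (p + q + r) / 6"
    if "x \<le> w" "- p \<le> b" "- q \<le> b" "- r \<le> b" for x w b p q r :: real
    using that by (simp add: field_simps)
  have "(m - N * norm ?h) / 2 * norm v ^ 2 = m * norm v ^ 2 / 2 - N * (norm ?h * norm v ^ 2) / 2"
    by (simp add: field_simps)
  also have "\<dots> \<le> taylor3_quad f a y v"
    using 1 2 [THEN abs_le_D2] unfolding taylor3_quad_def Let_def by (rule comb)
  finally show ?thesis .
qed

text \<open>The five-point difference quotient \<open>(8 (P s - P (-s)) - (P (2s) - P (-2s))) / (12 s)\<close> is the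
  exact derivative at \<open>0\<close> of a cubic \<open>P\<close>. With \<open>s\<close> equal to the distance from \<open>a\<close> to the minimiser
  it turns the fourth-order agreement of the two Taylor cubics into third-order agreement of their
  slopes.\<close>

lemma taylor3_linear_coeff_at_minimum:
  assumes diff: "three_times_differentiable f" and lip: "third_derivative_lipschitz f L"
    and min: "strict_global_minimum f xs"
  shows "\<bar>taylor3_lin f a xs v\<bar> \<le> 25 * \<bar>L\<bar> * norm (a - xs) ^ 3 * norm v"
proof (cases "a = xs \<or> v = 0")
  case True
  then show ?thesis
    using gradient_at_minimum [OF diff min, of v]
    by (auto simp: taylor3_lin_def tensor_form_alt)
next
  case False
  define d where "d = norm (a - xs)"
  define s where "s = d / norm v"
  have d: "0 < d" and s: "0 < s" and sv: "s * norm v = d" using False by (auto simp: d_def s_def)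
  define E where "E t = taylor3 f a (xs + t *\<^sub>R v) - taylor3 f xs (xs + t *\<^sub>R v)" for t
  have lin0: "taylor3_lin f xs xs v = 0"
    using gradient_at_minimum [OF diff min, of v] by (simp add: taylor3_lin_def tensor_form_alt)
  obtain c0 c2 c3 where E: "\<And>t. E t = c0 + t * taylor3_lin f a xs v + t^2 * c2 + t^3 * c3"
  proof
    show "E t = (taylor3 f a xs - taylor3 f xs xs) + t * taylor3_lin f a xs v
       + t^2 * (taylor3_quad f a xs v - taylor3_quad f xs xs v)
       + t^3 * (tensor_form (third_derivative f a) v v v / 6
                - tensor_form (third_derivative f xs) v v v / 6)" for t
      unfolding E_def taylor3_on_line lin0 by (simp add: algebra_simps)
  qed
  have key: "12 * s * taylor3_lin f a xs v = 8 * (E s - E (- s)) - (E (2 * s) - E (- (2 * s)))"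
    unfolding E by (simp add: algebra_simps power2_eq_square power3_eq_cube)
  \<comment> \<open>The distances to \<open>a\<close> and \<open>xs\<close> are at most \<open>3 d\<close> and \<open>2 d\<close>, and \<open>97 = 3\<^sup>4 + 2\<^sup>4\<close>.\<close>
  have Eb: "\<bar>E t\<bar> \<le> \<bar>L\<bar> / 6 * (97 * d ^ 4)" if "\<bar>t\<bar> \<le> 2 * s" for t
  proof -
    have tv: "norm (t *\<^sub>R v) \<le> 2 * d"
      using mult_right_mono [OF that, of "norm v"] sv by simp
    have nb: "norm (xs + t *\<^sub>R v - a) \<le> 3 * d"
      using norm_triangle_ineq [of "xs - a" "t *\<^sub>R v"] tv
      by (simp add: d_def norm_minus_commute algebra_simps)
    have "\<bar>f (xs + t *\<^sub>R v) - taylor3 f a (xs + t *\<^sub>R v)\<bar> \<le> \<bar>L\<bar> / 6 * norm (xs + t *\<^sub>R v - a) ^ 4"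
      using taylor3_error [OF diff lip, of a "xs + t *\<^sub>R v - a"] by simp
    also have "\<dots> \<le> \<bar>L\<bar> / 6 * (3 * d) ^ 4" using nb by (intro mult_left_mono power_mono) auto
    finally have 1: "\<bar>f (xs + t *\<^sub>R v) - taylor3 f a (xs + t *\<^sub>R v)\<bar> \<le> \<bar>L\<bar> / 6 * (81 * d ^ 4)"
      by (simp add: power_mult_distrib)
    have "\<bar>f (xs + t *\<^sub>R v) - taylor3 f xs (xs + t *\<^sub>R v)\<bar> \<le> \<bar>L\<bar> / 6 * norm (t *\<^sub>R v) ^ 4"
      by (rule taylor3_error [OF diff lip])
    also have "\<dots> \<le> \<bar>L\<bar> / 6 * (2 * d) ^ 4" using tv by (intro mult_left_mono power_mono) auto
    finally have 2: "\<bar>f (xs + t *\<^sub>R v) - taylor3 f xs (xs + t *\<^sub>R v)\<bar> \<le> \<bar>L\<bar> / 6 * (16 * d ^ 4)"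
      by (simp add: power_mult_distrib)
    show ?thesis using 1 2 unfolding E_def by argo
  qed
  have tri: "\<bar>8 * (x - x') - (w - w')\<bar> \<le> 18 * b"
    if "\<bar>x\<bar> \<le> b" "\<bar>x'\<bar> \<le> b" "\<bar>w\<bar> \<le> b" "\<bar>w'\<bar> \<le> b" for x x' w w' b :: real
    using that by (simp add: abs_le_iff)
  have "12 * s * \<bar>taylor3_lin f a xs v\<bar> = \<bar>12 * s * taylor3_lin f a xs v\<bar>"
    using s by (simp add: abs_mult)
  also have "\<dots> \<le> 18 * (\<bar>L\<bar> / 6 * (97 * d ^ 4))"
    unfolding key using s by (intro tri Eb) auto
  also have "\<dots> \<le> 300 * (\<bar>L\<bar> * d ^ 4)" by simp
  also have "\<dots> = 12 * s * (25 * \<bar>L\<bar> * d ^ 3 * norm v)"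
    by (simp add: sv [symmetric] eval_nat_numeral mult_ac)
  finally show ?thesis using s by (simp add: d_def mult_ac)
qed

section \<open>Local minima of cubic polynomials\<close>

lemma cubic_nonneg_near_zero:
  fixes \<alpha> \<beta> \<gamma> :: real
  assumes "\<forall>\<^sub>F t in at 0. 0 \<le> t * \<alpha> + t^2 * \<beta> + t^3 * \<gamma>"
  shows "\<alpha> = 0" and "0 \<le> \<beta>"
proof -
  let ?p = "\<lambda>t. t * \<alpha> + t^2 * \<beta> + t^3 * \<gamma>"
  obtain \<delta> where \<delta>: "0 < \<delta>" and nn: "\<And>t. t \<noteq> 0 \<Longrightarrow> \<bar>t\<bar> < \<delta> \<Longrightarrow> 0 \<le> ?p t"
    using assms unfolding eventually_at by (auto simp: dist_real_def)
  have "(?p has_real_derivative \<alpha>) (at 0)"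
    by (auto intro!: derivative_eq_intros)
  moreover have "\<forall>y. \<bar>0 - y\<bar> < \<delta> \<longrightarrow> ?p 0 \<le> ?p y"
  proof (intro allI impI)
    fix y assume "\<bar>0 - y\<bar> < \<delta>"
    then show "?p 0 \<le> ?p y" using nn [of y] by (cases "y = 0") auto
  qed
  ultimately show \<alpha>: "\<alpha> = 0" using DERIV_local_min [of ?p \<alpha> 0 \<delta>] \<delta> by blast
  \<comment> \<open>After division by \<open>t\<^sup>2\<close> the limit at \<open>0\<close> is \<open>\<beta>\<close>.\<close>
  have "((\<lambda>t. \<beta> + t * \<gamma>) \<longlongrightarrow> \<beta> + 0 * \<gamma>) (at 0)" by (intro tendsto_intros)
  moreover have "\<forall>\<^sub>F t in at 0. 0 \<le> \<beta> + t * \<gamma>"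
    unfolding eventually_at
  proof (intro exI [of _ \<delta>] conjI \<delta> ballI impI)
    fix t :: real assume t: "t \<noteq> 0 \<and> dist t 0 < \<delta>"
    then have "0 \<le> t^2 * (\<beta> + t * \<gamma>)"
      using nn [of t] \<alpha> by (simp add: algebra_simps power2_eq_square power3_eq_cube dist_real_def)
    then show "0 \<le> \<beta> + t * \<gamma>" using t by (simp add: zero_le_mult_iff)
  qed
  ultimately show "0 \<le> \<beta>" by (simp add: tendsto_lowerbound)
qed

lemma local_minimum_on_line:
  assumes "local_minimum q y"
  shows "\<forall>\<^sub>F t in at 0. q y \<le> q (y + t *\<^sub>R v)"
proof -
  obtain \<delta> where \<delta>: "0 < \<delta>" "\<And>z. z \<noteq> y \<Longrightarrow> dist z y < \<delta> \<Longrightarrow> q y \<le> q z"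
    using assms unfolding local_minimum_def eventually_at by auto
  have le: "q y \<le> q z" if "dist z y < \<delta>" for z using \<delta>(2) [of z] that by (cases "z = y") auto
  have "((\<lambda>t. y + t *\<^sub>R v) \<longlongrightarrow> y + 0 *\<^sub>R v) (at (0::real))" by (intro tendsto_intros)
  then have "\<forall>\<^sub>F t in at (0::real). dist (y + t *\<^sub>R v) y < \<delta>"
    using tendstoD \<delta>(1) by fastforce
  then show ?thesis by eventually_elim (rule le)
qed

text \<open>On a line through two local minima, at parameters \<open>0\<close> and \<open>1\<close>, the cubic
  \<open>t\<^sup>2 \<beta> + t\<^sup>3 \<gamma>\<close> has slope \<open>2 \<beta> + 3 \<gamma> = 0\<close> and half curvature \<open>\<beta> + 3 \<gamma> = - \<beta>\<close> at \<open>1\<close>.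
  So \<open>\<beta>\<close> cannot be positive.\<close>

lemma cubic_unique_local_minimum:
  fixes q :: "real ^ 'n::finite \<Rightarrow> real"
  assumes cubic: "\<And>v t. q (y + t *\<^sub>R v) = q y + t * A v + t^2 * Q v + t^3 * R v"
    and pos: "\<And>v. v \<noteq> 0 \<Longrightarrow> 0 < Q v"
    and y: "local_minimum q y" and z: "local_minimum q z"
  shows "z = y"
proof (rule ccontr)
  assume "z \<noteq> y"
  define v where "v = z - y"
  have Q: "0 < Q v" using pos \<open>z \<noteq> y\<close> by (simp add: v_def)
  have A: "A v = 0"
    using local_minimum_on_line [OF y, of v] cubic_nonneg_near_zero(1) [of "A v" "Q v" "R v"]
    by (simp add: cubic add.assoc)
  have zt: "q (z + t *\<^sub>R v) = q z + (t * (2 * Q v + 3 * R v) + t^2 * (Q v + 3 * R v) + t^3 * R v)" for t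
  proof -
    have "z + t *\<^sub>R v = y + (1 + t) *\<^sub>R v" and "z = y + 1 *\<^sub>R v" by (simp_all add: v_def algebra_simps)
    then show ?thesis
      using cubic [of "1 + t" v] cubic [of 1 v] A
      by (simp add: algebra_simps power2_eq_square power3_eq_cube)
  qed
  have "\<forall>\<^sub>F t in at 0. 0 \<le> t * (2 * Q v + 3 * R v) + t^2 * (Q v + 3 * R v) + t^3 * R v"
    using local_minimum_on_line [OF z, of v] by (simp add: zt)
  from cubic_nonneg_near_zero [OF this] Q show False by linarith
qed

text \<open>A minimiser \<open>y\<close> over the ball of radius \<open>r\<close> exists by compactness. For displacements of
  length at most \<open>r\<close> the cubic term costs at most half of the quadratic term, which leaves growth
  of at least \<open>m / 8 \<bar>v\<bar>\<^sup>2\<close>. So a slope of at most \<open>e\<close> at the centre can be exploited only up to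
  distance \<open>8 e / m < r\<close>, and \<open>y\<close> lies in the interior.\<close>

lemma cubic_local_minimum_near:
  fixes q :: "real ^ 'n::finite \<Rightarrow> real"
  assumes cubic: "\<And>y v t. q (y + t *\<^sub>R v) = q y + t * A y v + t^2 * Q y v + t^3 * R v"
    and cont: "continuous_on (cball x r) q"
    and Q: "\<And>y v. norm (y - x) \<le> r \<Longrightarrow> m / 4 * norm v ^ 2 \<le> Q y v"
    and R: "\<And>v. \<bar>R v\<bar> \<le> M * norm v ^ 3"
    and A: "\<And>v. \<bar>A x v\<bar> \<le> e * norm v"
    and m: "0 < m" and M: "0 \<le> M" "M * r \<le> m / 8" and e: "8 * e / m < r" and r: "0 < r"
  shows "\<exists>y. strict_local_minimum q y \<and> (\<forall>z. local_minimum q z \<longleftrightarrow> z = y)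
           \<and> norm (y - x) \<le> 8 * e / m"
proof -
  have lower: "m / 8 * norm v ^ 2 \<le> q (y + v) - q y - A y v"
    if "norm (y - x) \<le> r" "norm v \<le> r" for y v
  proof -
    have "M * norm v \<le> m / 8" using that(2) M by (smt (verit) mult_left_mono)
    then have "M * norm v * norm v ^ 2 \<le> m / 8 * norm v ^ 2" by (intro mult_right_mono) auto
    then have "\<bar>R v\<bar> \<le> m / 8 * norm v ^ 2"
      using R [of v] by (simp add: power2_eq_square power3_eq_cube mult_ac)
    moreover have "q (y + v) = q y + A y v + Q y v + R v" using cubic [of y 1 v] by simp
    ultimately show ?thesis using Q [OF that(1), of v] by argo
  qed
  have "compact (cball x r)" "cball x r \<noteq> {}" using r by auto
  then obtain y where y: "y \<in> cball x r" and ymin: "\<And>z. z \<in> cball x r \<Longrightarrow> q y \<le> q z"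
    using continuous_attains_inf [OF _ _ cont] by blast
  have yr: "norm (y - x) \<le> r" using y by (simp add: dist_norm norm_minus_commute)
  have dist: "norm (y - x) \<le> 8 * e / m"
  proof (cases "y = x")
    case True
    \<comment> \<open>The slope bound at any unit vector shows that \<open>e\<close> is nonnegative.\<close>
    have "0 \<le> e * norm (axis undefined 1 :: real ^ 'n)" using A [of "axis undefined 1"] by linarith
    then show ?thesis using True m by (simp add: norm_axis_1)
  next
    case False
    have "m / 8 * norm (y - x) ^ 2 \<le> q y - q x - A x (y - x)"
      using lower [of x "y - x"] yr r by simp
    also have "\<dots> \<le> e * norm (y - x)" using ymin [of x] r A [of "y - x"] by simp
    finally have "m / 8 * norm (y - x) \<le> e" using False by (simp add: power2_eq_square)
    then show ?thesis using m by (simp add: field_simps)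
  qed
  have interior: "y \<in> ball x r" using dist e by (simp add: dist_norm norm_minus_commute)
  have loc: "local_minimum q y"
    unfolding local_minimum_def
    using eventually_at_in_open' [OF open_ball interior] by eventually_elim (simp add: ymin)
  have Ay: "A y v = 0" for v
    using local_minimum_on_line [OF loc, of v] cubic_nonneg_near_zero(1) [of "A y v" "Q y v" "R v"]
    by (simp add: cubic add.assoc)
  have strict: "strict_local_minimum q y"
    unfolding strict_local_minimum_def eventually_at
  proof (intro exI [of _ r] conjI r ballI impI)
    fix z assume z: "z \<noteq> y \<and> dist z y < r"
    have "m / 8 * norm (z - y) ^ 2 \<le> q z - q y"
      using lower [OF yr, of "z - y"] z Ay by (simp add: dist_norm)
    moreover have "0 < m / 8 * norm (z - y) ^ 2" using z m by simp
    ultimately show "q y < q z" by linarith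
  qed
  have pos: "0 < Q y v" if "v \<noteq> 0" for v
  proof -
    have "0 < m / 4 * norm v ^ 2" using m that by simp
    then show ?thesis using Q [OF yr, of v] by linarith
  qed
  have "z = y" if "local_minimum q z" for z
    by (rule cubic_unique_local_minimum [of q y "A y" "Q y" R, OF cubic pos loc that])
  with strict loc dist show ?thesis by blast
qed

section \<open>Local cubic convergence\<close>

text \<open>\<open>N\<close> bounds the third derivative on the unit ball about \<open>xs\<close>. On the ball of radius
  \<open>m / (4 N)\<close> about \<open>xs\<close> points are at distance at most \<open>m / (2 N)\<close> from \<open>a\<close>, where the curvature
  \<open>m\<close> of the Taylor cubic at \<open>a\<close> has dropped at most to \<open>m / 2\<close>. The constant in \<open>C\<close> is
  \<open>200 = 8 * 25\<close>, with \<open>25 \<bar>L\<bar> d\<^sup>3\<close> the slope at \<open>xs\<close> and \<open>8 / m\<close> the factor from slope to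
  displacement. The summand \<open>1\<close> makes \<open>1 / C \<le> 1\<close>, so that \<open>d < 1 / C\<close> gives
  \<open>C d\<^sup>3 \<le> d\<close> and the step does not leave the ball of admissible starting points.\<close>

lemma newton3_step_cubic_bound:
  assumes diff: "three_times_differentiable f" and m: "0 < m" and conv: "strongly_convex f m"
    and lip: "third_derivative_lipschitz f L" and min: "strict_global_minimum f xs"
    and N: "N = tensor_norm (third_derivative f xs) + \<bar>L\<bar> + 1"
    and C: "C = 200 * \<bar>L\<bar> / m + 1"
    and a: "norm (a - xs) < m / (4 * N)" "norm (a - xs) < 1 / C"
  shows "newton3_step_well_defined f a \<and> norm (newton3_step f a - xs) \<le> C * norm (a - xs) ^ 3
    \<and> norm (newton3_step f a - xs) \<le> norm (a - xs)"
proof -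
  define d where "d = norm (a - xs)"
  define r where "r = m / (4 * N)"
  let ?T = "third_derivative f"
  have d0: "0 \<le> d" by (simp add: d_def)
  have C1: "1 \<le> C" using m by (simp add: C)
  have d1: "d < 1" using a(2) C1 by (simp add: d_def) (smt (verit) divide_le_eq_1)
  have N0: "0 < N" using tensor_norm_nonneg [of "?T xs"] by (simp add: N)
  have r0: "0 < r" using N0 m by (simp add: r_def)
  have dr: "d < r" using a(1) by (simp add: d_def r_def)
  have Ta: "tensor_norm (?T a) \<le> N"
  proof -
    have "tensor_norm (?T a - ?T xs) \<le> L * d"
      using lip by (simp add: third_derivative_lipschitz_def d_def)
    also have "\<dots> \<le> \<bar>L\<bar> * 1" using d0 d1 by (intro mult_mono) auto
    finally show ?thesis using tensor_norm_triangle [of "?T a" "?T xs"] by (simp add: N)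
  qed
  have "C * d \<le> 1" using a(2) C1 by (simp add: d_def field_simps)
  then have "C * d * d ^ 2 \<le> 1 * d ^ 2" by (intro mult_right_mono) auto
  also have "\<dots> \<le> d" using d0 d1 by (simp add: power2_eq_square mult_left_le_one_le)
  finally have Cd: "C * d ^ 3 \<le> d" by (simp add: power2_eq_square power3_eq_cube mult_ac)
  have C_bound: "8 * (25 * \<bar>L\<bar> * d ^ 3) / m \<le> C * d ^ 3" using d0 by (simp add: C algebra_simps)
  have ex: "\<exists>y. strict_local_minimum (taylor3 f a) y \<and> (\<forall>z. local_minimum (taylor3 f a) z \<longleftrightarrow> z = y)
      \<and> norm (y - xs) \<le> 8 * (25 * \<bar>L\<bar> * d ^ 3) / m"
  proof (rule cubic_local_minimum_near [where A = "taylor3_lin f a" and Q = "taylor3_quad f a"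
        and R = "\<lambda>v. tensor_form (?T a) v v v / 6" and r = r and M = "N / 6"])
    show "taylor3 f a (y + t *\<^sub>R v) = taylor3 f a y + t * taylor3_lin f a y v
       + t^2 * taylor3_quad f a y v + t^3 * (tensor_form (?T a) v v v / 6)" for y v t
      by (rule taylor3_on_line)
    show "continuous_on (cball xs r) (taylor3 f a)" by (rule continuous_on_taylor3)
    show "m / 4 * norm v ^ 2 \<le> taylor3_quad f a y v" if "norm (y - xs) \<le> r" for y v
    proof -
      have "norm (y - a) \<le> 2 * r"
        using norm_triangle_ineq4 [of "y - xs" "a - xs"] that dr by (simp add: d_def)
      then have "N * norm (y - a) \<le> N * (2 * r)" using N0 by simp
      also have "\<dots> = m / 2" using N0 by (simp add: r_def)
      finally have "m / 4 \<le> (m - N * norm (y - a)) / 2" by simp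
      then have "m / 4 * norm v ^ 2 \<le> (m - N * norm (y - a)) / 2 * norm v ^ 2"
        by (intro mult_right_mono) auto
      also have "\<dots> \<le> taylor3_quad f a y v" by (rule taylor3_quad_lower_bound [OF conv Ta])
      finally show ?thesis .
    qed
    show "\<bar>tensor_form (?T a) v v v / 6\<bar> \<le> N / 6 * norm v ^ 3" for v
    proof -
      have "tensor_norm (?T a) * norm v ^ 3 \<le> N * norm v ^ 3" using Ta by (intro mult_right_mono) auto
      then show ?thesis
        using abs_tensor_form_le [of "?T a" v v v] by (simp add: power3_eq_cube mult.assoc)
    qed
    show "\<bar>taylor3_lin f a xs v\<bar> \<le> 25 * \<bar>L\<bar> * d ^ 3 * norm v" for v
      unfolding d_def by (rule taylor3_linear_coeff_at_minimum [OF diff lip min])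
    show "N / 6 * r \<le> m / 8" using N0 m by (simp add: r_def)
    show "8 * (25 * \<bar>L\<bar> * d ^ 3) / m < r" using C_bound Cd dr by linarith
  qed (use m N0 r0 in auto)
  then obtain y where y: "strict_local_minimum (taylor3 f a) y"
    "\<And>z. local_minimum (taylor3 f a) z \<longleftrightarrow> z = y"
    "norm (y - xs) \<le> 8 * (25 * \<bar>L\<bar> * d ^ 3) / m" by blast
  have step: "newton3_step f a = y" by (simp add: newton3_step_def y(2))
  have wd: "newton3_step_well_defined f a"
    unfolding newton3_step_well_defined_def using y(1,2) by blast
  show ?thesis using y(3) C_bound Cd wd unfolding step d_def by linarith
qed

theorem theorem3p2:
  fixes f :: "real ^ 'n::finite \<Rightarrow> real" and m L :: real and xstar :: "real ^ 'n"
  assumes "three_times_differentiable f"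
    and "0 < m" and "strongly_convex f m"
    and "third_derivative_lipschitz f L"
    and "strict_global_minimum f xstar"
  shows "\<exists>C D. 0 < C \<and> 0 < D \<and>
    (\<forall>\<epsilon> x0. 0 < \<epsilon> \<longrightarrow> norm (x0 - xstar) < D \<longrightarrow>
      (\<forall>k. newton3_performs_step f \<epsilon> x0 k \<longrightarrow>
        newton3_step_well_defined f (newton3_iterate f x0 k) \<and>
        norm (newton3_iterate f x0 (Suc k) - xstar) \<le> C * norm (newton3_iterate f x0 k - xstar) ^ 3))"
proof -
  define N where "N = tensor_norm (third_derivative f xstar) + \<bar>L\<bar> + 1"
  define C where "C = 200 * \<bar>L\<bar> / m + 1"
  define D where "D = min (m / (4 * N)) (1 / C)"
  have N0: "0 < N" using tensor_norm_nonneg [of "third_derivative f xstar"] by (simp add: N_def)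
  have C0: "0 < C" using \<open>0 < m\<close> by (simp add: C_def add_nonneg_pos)
  have D0: "0 < D" using N0 C0 \<open>0 < m\<close> by (simp add: D_def)
  have step: "newton3_step_well_defined f a \<and> norm (newton3_step f a - xstar) \<le> C * norm (a - xstar) ^ 3
     \<and> norm (newton3_step f a - xstar) \<le> norm (a - xstar)" if "norm (a - xstar) < D" for a
    using newton3_step_cubic_bound [OF assms N_def C_def, of a] that by (simp add: D_def)
  have stay: "norm (newton3_iterate f x0 k - xstar) < D" if "norm (x0 - xstar) < D" for x0 k
  proof (induction k)
    case 0
    show ?case using that by simp
  next
    case (Suc k)
    then show ?case using step [of "newton3_iterate f x0 k"] by simp
  qed
  show ?thesis
    using C0 D0 step stay by (intro exI [of _ C] exI [of _ D]) auto
qed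

end
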